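(* Let $G$ be an $r$-regular graph with $n$ vertices and $m$ edges, and let $\lambda_1=r\ge\lambda_2\ge\dots\ge\lambda_n$ be the adjacency eigenvalues of $G$ (with $\lambda_1=r$ corresponding to the all-ones eigenvector). Then the Kemeny's constant of the central graph $C(G)$ is $$K(C(G))=m-n+\frac{n-1}{n-1+r}+\sum_{i=2}^{n}\frac{2(2n+\lambda_i-1)}{2n+\lambda_i-r}.$$
   Context: All graphs are finite, simple and undirected. The central graph $C(G)$ is obtained from $G$ by subdividing each edge exactly once and joining all pairs of vertices of $G$ that are non-adjacent in $G$. For a connected graph $H$ on $N$ vertices with normalized Laplacian $\mathcal{L}(H)=I-D(H)^{-1/2}A(H)D(H)^{-1/2}$ and normalized Laplacian eigenvalues $0=\tilde{\mu}_1(H)<\tilde{\mu}_2(H)\le\dots\le\tilde{\mu}_N(H)$, the Kemeny's constant is $K(H)=\sum_{i=2}^{N}\frac{1}{\tilde{\mu}_i(H)}$. *)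

theory Defs
  imports
    "Graph_Theory.Pair_Digraph"
    "Graph_Theory.Digraph_Component"
    "Jordan_Normal_Form.Char_Poly"
    "HOL-Computational_Algebra.Polynomial"
begin

(* A finite simple undirected graph is a pair_graph: each undirected edge {u,v} is
   represented by the two arcs (u,v) and (v,u). *)

definition edges :: "'a pair_pre_digraph \<Rightarrow> 'a set set" where
  "edges G = (\<lambda>(u, v). {u, v}) ` parcs G"

definition vertex_degree :: "'a pair_pre_digraph \<Rightarrow> 'a \<Rightarrow> nat" where
  "vertex_degree G v = out_degree (with_proj G) v"

definition regular :: "nat \<Rightarrow> 'a pair_pre_digraph \<Rightarrow> bool" where
  "regular r G \<longleftrightarrow> (\<forall>v \<in> pverts G. vertex_degree G v = r)"

(* Inl v is the original vertex v, Inr e the vertex subdividing the edge e. *)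
definition central_graph :: "'a pair_pre_digraph \<Rightarrow> ('a + 'a set) pair_pre_digraph" where
  "central_graph G = \<lparr>
     pverts = Inl ` pverts G \<union> Inr ` edges G,
     parcs = {(Inl u, Inr e) | u e. e \<in> edges G \<and> u \<in> e}
           \<union> {(Inr e, Inl u) | u e. e \<in> edges G \<and> u \<in> e}
           \<union> {(Inl u, Inl v) | u v. u \<in> pverts G \<and> v \<in> pverts G \<and> u \<noteq> v \<and> (u, v) \<notin> parcs G} \<rparr>"

(* An arbitrary ordering of the vertices, fixing the rows and columns of the matrices below;
   the eigenvalues do not depend on it. *)
definition vertex_list :: "'a pair_pre_digraph \<Rightarrow> 'a list" where
  "vertex_list G = (SOME vs. distinct vs \<and> set vs = pverts G)"

definition adjacency_matrix :: "'a pair_pre_digraph \<Rightarrow> real mat" where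
  "adjacency_matrix G =
     mat (card (pverts G)) (card (pverts G))
       (\<lambda>(i, j). if (vertex_list G ! i, vertex_list G ! j) \<in> parcs G then 1 else 0)"

(* D(G)^(-1/2), with entry 0 at an isolated vertex; a connected graph has
   an isolated vertex only if it is a single vertex. *)
definition inv_sqrt_degree_matrix :: "'a pair_pre_digraph \<Rightarrow> real mat" where
  "inv_sqrt_degree_matrix G =
     mat_diag (card (pverts G)) (\<lambda>i. 1 / sqrt (real (vertex_degree G (vertex_list G ! i))))"

definition normalized_laplacian :: "'a pair_pre_digraph \<Rightarrow> real mat" where
  "normalized_laplacian G =
     1\<^sub>m (card (pverts G)) -
     inv_sqrt_degree_matrix G * adjacency_matrix G * inv_sqrt_degree_matrix G"

(* Real eigenvalues with algebraic multiplicity, in nondecreasing order. All matrices used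
   here are symmetric, so these are all the eigenvalues. *)
definition eigenvalue_list :: "real mat \<Rightarrow> real list" where
  "eigenvalue_list A = sorted_list_of_multiset (proots (char_poly A))"

(* The i-th largest adjacency eigenvalue, i = 1, ..., n. *)
definition adjacency_eigenvalue :: "'a pair_pre_digraph \<Rightarrow> nat \<Rightarrow> real" where
  "adjacency_eigenvalue G i = rev (eigenvalue_list (adjacency_matrix G)) ! (i - 1)"

(* The i-th smallest normalized Laplacian eigenvalue, i = 1, ..., N. *)
definition normalized_laplacian_eigenvalue :: "'a pair_pre_digraph \<Rightarrow> nat \<Rightarrow> real" where
  "normalized_laplacian_eigenvalue H i = eigenvalue_list (normalized_laplacian H) ! (i - 1)"

(* Only meaningful for connected H. *)
definition kemeny_constant :: "'a pair_pre_digraph \<Rightarrow> real" where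
  "kemeny_constant H =
     (\<Sum>i = 2..card (pverts H). 1 / normalized_laplacian_eigenvalue H i)"

lemma pair_graph_central_graph:
  assumes "pair_graph G"
  shows "pair_graph (central_graph G)"
proof -
  interpret pair_graph G by fact
  have fe: "finite (edges G)"
    unfolding edges_def using pair_finite_arcs by simp
  have wf: "u \<in> pverts G" if "e \<in> edges G" "u \<in> e" for u e
    using that by (auto simp: edges_def dest: in_arcsD1 in_arcsD2)
  have sub: "parcs (central_graph G) \<subseteq> pverts (central_graph G) \<times> pverts (central_graph G)"
    using wf by (auto simp: central_graph_def)
  have fv: "finite (pverts (central_graph G))"
    using fe pair_finite_verts by (simp add: central_graph_def)
  show ?thesis
  proof
    show "fst e \<in> pverts (central_graph G)" if "e \<in> parcs (central_graph G)" for e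
      using that sub by auto
    show "snd e \<in> pverts (central_graph G)" if "e \<in> parcs (central_graph G)" for e
      using that sub by auto
    show "finite (pverts (central_graph G))" by (fact fv)
    show "finite (parcs (central_graph G))"
      using finite_subset[OF sub] fv by blast
    show "fst e \<noteq> snd e" if "e \<in> parcs (central_graph G)" for e
      using that by (auto simp: central_graph_def)
    show "symmetric (with_proj (central_graph G))"
      unfolding symmetric_def sym_def by (auto simp: central_graph_def dest: arcs_symmetric)
  qed
qed

lemma connected_central_graph:
  assumes "pair_graph G" and "pverts G \<noteq> {}"
  shows "Digraph_Component.connected (with_proj (central_graph G))"
proof -
  interpret pair_graph G by fact
  define C where "C = central_graph G"
  interpret C: pair_graph C
    unfolding C_def using assms(1) by (rule pair_graph_central_graph)
  note tr = C.reachable_trans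
  have arc: "u \<rightarrow>\<^sup>*\<^bsub>with_proj C\<^esub> v" if "(u, v) \<in> parcs C" for u v
    using that by (intro C.reachable_adjI) simp
  have LL: "Inl u \<rightarrow>\<^sup>*\<^bsub>with_proj C\<^esub> Inl v" if uv: "u \<in> pverts G" "v \<in> pverts G" for u v
  proof -
    consider "u = v" | "u \<noteq> v" "(u, v) \<notin> parcs G" | "(u, v) \<in> parcs G" by blast
    then show ?thesis
    proof cases
      case 1
      have "Inl u \<in> pverts C" using uv by (auto simp: C_def central_graph_def)
      then show ?thesis using 1 by (simp add: C.reachable_refl)
    next
      case 2
      then show ?thesis using uv by (intro arc) (auto simp: C_def central_graph_def)
    next
      case 3
      then have e: "{u, v} \<in> edges G" by (force simp: edges_def)
      then have "(Inl u, Inr {u, v}) \<in> parcs C" "(Inr {u, v}, Inl v) \<in> parcs C"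
        by (auto simp: C_def central_graph_def)
      then show ?thesis by (rule tr[OF arc arc])
    qed
  qed
  have toL: "\<exists>u \<in> pverts G. x \<rightarrow>\<^sup>*\<^bsub>with_proj C\<^esub> Inl u \<and> Inl u \<rightarrow>\<^sup>*\<^bsub>with_proj C\<^esub> x"
    if "x \<in> pverts C" for x
  proof (cases x)
    case (Inl u)
    then show ?thesis using that LL by (auto simp: C_def central_graph_def)
  next
    case (Inr e)
    then have e: "e \<in> edges G" using that by (auto simp: C_def central_graph_def)
    then obtain u v where uv: "(u, v) \<in> parcs G" "e = {u, v}" by (auto simp: edges_def)
    then have "u \<in> pverts G" by (auto dest: in_arcsD1)
    moreover have "(Inl u, x) \<in> parcs C" "(x, Inl u) \<in> parcs C"
      using e uv Inr by (auto simp: C_def central_graph_def)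
    ultimately show ?thesis using arc by blast
  qed
  have "strongly_connected (with_proj C)"
  proof
    show "verts (with_proj C) \<noteq> {}"
      using assms(2) by (simp add: C_def central_graph_def)
  next
    fix x y assume "x \<in> verts (with_proj C)" "y \<in> verts (with_proj C)"
    then obtain u v where "u \<in> pverts G" "v \<in> pverts G"
      "x \<rightarrow>\<^sup>*\<^bsub>with_proj C\<^esub> Inl u" "Inl v \<rightarrow>\<^sup>*\<^bsub>with_proj C\<^esub> y"
      using toL by (metis with_proj_simps(1))
    then show "x \<rightarrow>\<^sup>*\<^bsub>with_proj C\<^esub> y" using tr[OF tr[OF _ LL]] by simp
  qed
  then show ?thesis
    unfolding C_def[symmetric] Digraph_Component.connected_def strongly_connected_def
    by (simp add: C.reachable_mk_symmetricI)
qed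

end

theory Submission
  imports Defs
begin

text \<open>
  Order the vertices of the central graph with the original ones first and write \<open>y = x - 1\<close>,
  \<open>t = n - 1\<close>. Since every original vertex has degree \<open>t\<close> and every subdividing vertex has degree 2,
  \<open>x I - L\<close> is a block matrix whose lower right block is \<open>y I\<close>. Its Schur complement involves only
  \<open>I\<close>, \<open>A\<close>, the all-ones matrix \<open>J\<close> and \<open>B B\<^sup>T = A + r I\<close>, with \<open>B\<close> the incidence matrix. As the
  rows of \<open>A\<close> sum to \<open>r\<close>, the matrix \<open>J\<close> only affects the factor of the eigenvalue \<open>r\<close>, and
  \<open>(x - 1)\<^sup>n \<chi>(x) = (x - 1)\<^sup>m x (x - (1 + r / t)) \<Prod> q\<^sub>l(x)\<close>, where \<open>l\<close> ranges over the other
  adjacency eigenvalues and each quadratic \<open>q\<^sub>l\<close> has two positive roots. The sum of the reciprocals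
  of these roots is read off the coefficients of \<open>q\<^sub>l\<close>. Keeping \<open>(x - 1)\<^sup>n\<close> on the left avoids
  assuming \<open>m \<ge> n\<close>. In the sum over all roots the eigenvalue 0 contributes \<open>1 / 0 = 0\<close>.
\<close>

section \<open>Determinants: reordering, Schur complements, rank-one updates\<close>

text \<open>Permuting rows and permuting columns each contribute a factor \<open>signof p\<close>,
  and the two signs cancel. Columns are reduced to rows by transposing.\<close>

lemma det_mat_permute_both:
  fixes f :: "nat \<Rightarrow> nat \<Rightarrow> 'a :: comm_ring_1"
  assumes p: "p permutes {0..<n}"
  shows "det (mat n n (\<lambda>(i, j). f (p i) (p j))) = det (mat n n (\<lambda>(i, j). f i j))"
proof -
  have pn: "p i < n" if "i < n" for i
    using permutes_in_image[OF p, of i] that by simp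
  let ?C = "mat n n (\<lambda>(i, j). f i (p j))"
  have "det (mat n n (\<lambda>(i, j). f (p i) (p j))) = det (mat n n (\<lambda>(i, j). ?C $$ (p i, j)))"
    by (intro arg_cong[where f = det]) (auto simp: pn)
  also have "\<dots> = signof p * det ?C"
    by (rule det_permute_rows[OF _ p]) simp
  also have "det ?C = det (transpose_mat ?C)"
    by (rule det_transpose[of _ n, symmetric]) simp
  also have "transpose_mat ?C =
      mat n n (\<lambda>(i, j). transpose_mat (mat n n (\<lambda>(i, j). f i j)) $$ (p i, j))"
    by (auto simp: pn)
  also have "det \<dots> = signof p * det (transpose_mat (mat n n (\<lambda>(i, j). f i j)))"
    by (rule det_permute_rows[OF _ p]) simp
  also have "det (transpose_mat (mat n n (\<lambda>(i, j). f i j))) = det (mat n n (\<lambda>(i, j). f i j))"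
    by (rule det_transpose[of _ n]) simp
  finally show ?thesis
    by (cases p rule: sign_cases) simp_all
qed

text \<open>As \<open>vertex_list\<close> is an arbitrary choice, this is what allows passing to an
  ordering of the vertices that exhibits the block structure.\<close>

lemma det_mat_mset_eq:
  fixes f :: "'b \<Rightarrow> 'b \<Rightarrow> 'a :: comm_ring_1"
  assumes "mset xs = mset ys"
  shows "det (mat (length xs) (length xs) (\<lambda>(i, j). f (xs ! i) (xs ! j))) =
    det (mat (length ys) (length ys) (\<lambda>(i, j). f (ys ! i) (ys ! j)))"
proof -
  obtain p where p: "p permutes {..<length ys}" "permute_list p ys = xs"
    using mset_eq_permutation[OF assms] by blast
  have len: "length xs = length ys"
    using assms by (rule mset_eq_length)
  have "mat (length xs) (length xs) (\<lambda>(i, j). f (xs ! i) (xs ! j)) =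
      mat (length ys) (length ys) (\<lambda>(i, j). f (ys ! p i) (ys ! p j))"
    using p by (auto simp: len permute_list_nth)
  also have "det \<dots> = det (mat (length ys) (length ys) (\<lambda>(i, j). f (ys ! i) (ys ! j)))"
    using p(1) by (intro det_mat_permute_both) (simp add: lessThan_atLeast0)
  finally show ?thesis .
qed

text \<open>Schur complement with cleared denominators: the factor \<open>?E\<close>, of determinant
  \<open>y ^ n\<close>, eliminates the lower left block without dividing by \<open>y\<close>, so the
  identity also holds at \<open>y = 0\<close>.\<close>

lemma det_four_block_scalar_lower_right:
  fixes P :: "'a :: idom mat"
  assumes P: "P \<in> carrier_mat n n" and Q: "Q \<in> carrier_mat n m" and R: "R \<in> carrier_mat m n"
  shows "det (four_block_mat P Q R (y \<cdot>\<^sub>m 1\<^sub>m m)) * y ^ n = det (y \<cdot>\<^sub>m P - Q * R) * y ^ m"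
proof -
  let ?M = "four_block_mat P Q R (y \<cdot>\<^sub>m 1\<^sub>m m)"
  let ?E = "four_block_mat (y \<cdot>\<^sub>m 1\<^sub>m n) (0\<^sub>m n m) (- R) (1\<^sub>m m)"
  have E: "det ?E = y ^ n"
    using R by (subst det_four_block_mat_upper_right_zero[of _ n _ m]) auto
  have yR: "y \<cdot>\<^sub>m 1\<^sub>m m * R = y \<cdot>\<^sub>m R"
    using R by (subst mult_smult_assoc_mat[of _ m m _ n]) auto
  have PM: "P * (y \<cdot>\<^sub>m 1\<^sub>m n) = y \<cdot>\<^sub>m P"
    using P by (subst mult_smult_distrib[of _ n n _ n]) auto
  have RM: "R * (y \<cdot>\<^sub>m 1\<^sub>m n) = y \<cdot>\<^sub>m R"
    using R by (subst mult_smult_distrib[of _ m n _ n]) auto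
  have "?M * ?E = four_block_mat (P * (y \<cdot>\<^sub>m 1\<^sub>m n) + Q * (- R)) (P * 0\<^sub>m n m + Q * 1\<^sub>m m)
      (R * (y \<cdot>\<^sub>m 1\<^sub>m n) + (y \<cdot>\<^sub>m 1\<^sub>m m) * (- R)) (R * 0\<^sub>m n m + (y \<cdot>\<^sub>m 1\<^sub>m m) * 1\<^sub>m m)"
    using P Q R by (intro mult_four_block_mat) auto
  also have "\<dots> = four_block_mat (y \<cdot>\<^sub>m P - Q * R) Q (0\<^sub>m m n) (y \<cdot>\<^sub>m 1\<^sub>m m)"
    using P Q R by (intro cong_four_block_mat) (auto simp: PM RM yR)
  also have "det \<dots> = det (y \<cdot>\<^sub>m P - Q * R) * y ^ m"
    using P Q R by (subst det_four_block_mat_lower_left_zero[of _ n _ m]) auto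
  finally have "det (?M * ?E) = det (y \<cdot>\<^sub>m P - Q * R) * y ^ m" .
  moreover have "det (?M * ?E) = det ?M * det ?E"
    using P Q R by (intro det_mult[of _ "n + m"]) (auto intro!: four_block_carrier_mat)
  ultimately show ?thesis
    by (simp add: E)
qed

text \<open>Sylvester's identity: both sides are the determinant of the block matrix
  \<open>?M\<close>, reduced to one or the other diagonal corner.\<close>

lemma det_one_plus_mult_commute:
  fixes U :: "'a :: idom mat"
  assumes U: "U \<in> carrier_mat n k" and V: "V \<in> carrier_mat k n"
  shows "det (1\<^sub>m n + U * V) = det (1\<^sub>m k + V * U)"
proof -
  let ?M = "four_block_mat (1\<^sub>m n) (- U) V (1\<^sub>m k)"
  let ?E = "four_block_mat (1\<^sub>m n) (0\<^sub>m n k) (- V) (1\<^sub>m k)"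
  have E: "det ?E = 1"
    using V by (subst det_four_block_mat_upper_right_zero[of _ n _ k]) auto
  have "?E * ?M = four_block_mat (1\<^sub>m n * 1\<^sub>m n + 0\<^sub>m n k * V) (1\<^sub>m n * (- U) + 0\<^sub>m n k * 1\<^sub>m k)
      (- V * 1\<^sub>m n + 1\<^sub>m k * V) (- V * (- U) + 1\<^sub>m k * 1\<^sub>m k)"
    using U V by (intro mult_four_block_mat) auto
  also have "\<dots> = four_block_mat (1\<^sub>m n) (- U) (0\<^sub>m k n) (1\<^sub>m k + V * U)"
    using U V by (intro cong_four_block_mat) (auto intro!: comm_add_mat[of _ k k])
  also have "det \<dots> = det (1\<^sub>m k + V * U)"
    using U V by (subst det_four_block_mat_lower_left_zero[of _ n _ k]) auto
  finally have "det (?E * ?M) = det (1\<^sub>m k + V * U)" .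
  moreover have "det (?E * ?M) = det ?E * det ?M"
    using U V by (intro det_mult[of _ "n + k"]) (auto intro!: four_block_carrier_mat)
  moreover have "det ?M = det (1\<^sub>m n + U * V)"
  proof -
    have one: "1 \<cdot>\<^sub>m B = B" for B :: "'a mat"
      by auto
    \<comment> \<open>The Schur complement subtracts the product of the off-diagonal blocks; the
      sign in \<open>- U\<close> turns this into a sum.\<close>
    have "det (1\<^sub>m n - - U * V) = det (1\<^sub>m n + U * V)"
      using U V by (intro arg_cong[where f = det]) auto
    then show ?thesis
      using det_four_block_scalar_lower_right[of "1\<^sub>m n" n "- U" k V 1] U V
      by (simp add: one)
  qed
  ultimately show ?thesis
    by (simp add: E)
qed

text \<open>Constant row sums make the all-ones vector an eigenvector of \<open>C\<close> for
  \<open>s\<close>. If \<open>s\<close> is nonzero, the added matrix is \<open>C\<close> times a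
  rank-one matrix with entries \<open>c / s\<close>, and Sylvester's identity leaves a 1 by 1
  determinant. If \<open>s = 0\<close>, both sides vanish, since \<open>C\<close> is singular unless
  \<open>n = 0\<close>.\<close>

lemma det_add_const_mat:
  fixes C :: "'a :: field mat"
  assumes C: "C \<in> carrier_mat n n"
    and row_sum: "\<And>i. i < n \<Longrightarrow> (\<Sum>j<n. C $$ (i, j)) = s"
  shows "s * det (C + mat n n (\<lambda>_. c)) = (s + c * of_nat n) * det C"
proof (cases "s = 0")
  case True
  show ?thesis
  proof (cases "n = 0")
    case False
    have "C *\<^sub>v vec n (\<lambda>_. 1) = 0\<^sub>v n"
      using C row_sum True by (auto simp: scalar_prod_def lessThan_atLeast0)
    moreover have "vec n (\<lambda>_. 1 :: 'a) \<noteq> 0\<^sub>v n"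
      using False by (auto simp: vec_eq_iff)
    ultimately have "det C = 0"
      unfolding det_0_iff_vec_prod_zero_field[OF C] by (intro exI[of _ "vec n (\<lambda>_. 1)"]) simp
    then show ?thesis using True by simp
  qed (simp add: True)
next
  case False
  define U where "U = mat n 1 (\<lambda>_. c / s)"
  define V where "V = mat 1 n (\<lambda>_. 1 :: 'a)"
  have U: "U \<in> carrier_mat n 1" and V: "V \<in> carrier_mat 1 n"
    by (simp_all add: U_def V_def)
  have "C * (U * V) = mat n n (\<lambda>_. c)"
  proof (rule eq_matI)
    fix i j assume "i < dim_row (mat n n (\<lambda>_. c))" "j < dim_col (mat n n (\<lambda>_. c))"
    then have ij: "i < n" "j < n" by auto
    have "(C * (U * V)) $$ (i, j) = (\<Sum>k<n. C $$ (i, k) * (c / s))"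
      using ij C by (simp add: U_def V_def scalar_prod_def lessThan_atLeast0)
    also have "\<dots> = c"
      using False row_sum[OF ij(1)] by (simp flip: sum_distrib_right sum_divide_distrib)
    finally show "(C * (U * V)) $$ (i, j) = mat n n (\<lambda>_. c) $$ (i, j)"
      using ij by simp
  qed (use C V in auto)
  then have "C + mat n n (\<lambda>_. c) = C * (1\<^sub>m n + U * V)"
    using C U V by (subst mult_add_distrib_mat[of _ n n _ n]) auto
  then have "det (C + mat n n (\<lambda>_. c)) = det C * det (1\<^sub>m 1 + V * U)"
    using C U V by (simp add: det_mult[of _ n] det_one_plus_mult_commute[of U n 1 V])
  also have "det (1\<^sub>m 1 + V * U) = 1 + of_nat n * (c / s)"
    using U V by (subst det_single) (auto simp: U_def V_def scalar_prod_def)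
  finally show ?thesis
    using False by (simp add: field_simps)
qed

section \<open>Spectra of real symmetric matrices\<close>

text \<open>The Hermitian form \<open>S\<close> of an eigenvector equals its own conjugate by
  symmetry, and it is also \<open>a\<close> times the positive real number \<open>T\<close>.\<close>

lemma symmetric_real_mat_complex_eigenvalue:
  fixes A :: "real mat"
  assumes A: "A \<in> carrier_mat n n" and sym: "transpose_mat A = A"
    and ev: "eigenvalue (map_mat complex_of_real A) a"
  shows "a \<in> \<real>"
proof -
  obtain v where v: "v \<in> carrier_vec n" "v \<noteq> 0\<^sub>v n"
    and Av: "map_mat complex_of_real A *\<^sub>v v = a \<cdot>\<^sub>v v"
    using ev A unfolding eigenvalue_def eigenvector_def by auto
  have symA: "A $$ (i, j) = A $$ (j, i)" if "i < n" "j < n" for i j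
    using that A arg_cong[OF sym, of "\<lambda>B. B $$ (i, j)"] by simp
  have Avi: "(\<Sum>j<n. of_real (A $$ (i, j)) * v $ j) = a * v $ i" if "i < n" for i
    using that A v arg_cong[OF Av, of "\<lambda>w. w $ i"] by (simp add: scalar_prod_def lessThan_atLeast0)
  define S where "S = (\<Sum>i<n. \<Sum>j<n. of_real (A $$ (i, j)) * v $ j * cnj (v $ i))"
  define T where "T = (\<Sum>i<n. (cmod (v $ i))\<^sup>2)"
  have "S = (\<Sum>i<n. a * v $ i * cnj (v $ i))"
    unfolding S_def by (intro sum.cong refl) (simp add: Avi flip: sum_distrib_right)
  then have ST: "S = a * of_real T"
    by (simp add: T_def sum_distrib_left mult.assoc complex_norm_square del: of_real_power)
  have "cnj S = (\<Sum>i<n. \<Sum>j<n. of_real (A $$ (i, j)) * cnj (v $ j) * v $ i)"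
    by (simp add: S_def)
  also have "\<dots> = (\<Sum>i<n. \<Sum>j<n. of_real (A $$ (j, i)) * cnj (v $ i) * v $ j)"
    by (rule sum.swap)
  also have "\<dots> = S"
    unfolding S_def by (intro sum.cong refl) (simp add: symA)
  finally have "cnj S = S" .
  moreover have "T \<noteq> 0"
  proof
    assume "T = 0"
    then have "v $ i = 0" if "i < n" for i
      using that by (auto simp: T_def sum_nonneg_eq_0_iff)
    then show False using v by (auto simp: vec_eq_iff)
  qed
  ultimately have "cnj a = a"
    by (simp add: ST)
  then show ?thesis
    by (simp add: Reals_cnj_iff)
qed

text \<open>The characteristic polynomial splits over the complex numbers with real roots only, and
  the embedding of real polynomials is injective, so the factorization descends. Hence
  \<open>proots\<close> over the reals misses no eigenvalue.\<close>

lemma symmetric_real_mat_char_poly_splits: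
  fixes A :: "real mat"
  assumes A: "A \<in> carrier_mat n n" and sym: "transpose_mat A = A"
  shows "size (proots (char_poly A)) = n"
    and "char_poly A = (\<Prod>a\<in>#proots (char_poly A). [:- a, 1:])"
proof -
  let ?B = "map_mat complex_of_real A"
  have B: "?B \<in> carrier_mat n n" using A by simp
  obtain as where as: "char_poly ?B = (\<Prod>a\<leftarrow>as. [:- a, 1:])" "length as = n"
    using char_poly_factorized[OF B] by blast
  have "a \<in> \<real>" if "a \<in> set as" for a
  proof -
    have "poly (char_poly ?B) a = 0"
      using that by (force simp: as(1) poly_prod_list prod_list_zero_iff)
    then show ?thesis
      using symmetric_real_mat_complex_eigenvalue[OF A sym] eigenvalue_root_char_poly[OF B] by blast
  qed
  then obtain bs where bs: "as = map complex_of_real bs"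
    by (metis Reals_cases ex_map_conv)
  interpret of_real_poly: map_poly_inj_idom_hom complex_of_real ..
  have "map_poly complex_of_real (char_poly A) =
      map_poly complex_of_real (\<Prod>a\<leftarrow>bs. [:- a, 1:])"
    using as(1) by (simp add: of_real_hom.char_poly_hom[OF A] bs of_real_poly.hom_prod_list o_def)
  then have fac: "char_poly A = (\<Prod>a\<leftarrow>bs. [:- a, 1:])"
    by (rule of_real_poly.injectivity)
  have "proots (\<Prod>a\<leftarrow>bs. [:- a, 1:]) = mset bs" for bs :: "real list"
  proof (induction bs)
    case (Cons b bs)
    have "(\<Prod>a\<leftarrow>bs. [:- a, 1:]) \<noteq> 0"
      by (auto simp: prod_list_zero_iff)
    then show ?case
      using Cons by (simp add: proots_mult del: mult_pCons_left)
  qed simp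
  then have proots: "proots (char_poly A) = mset bs"
    unfolding fac .
  show "size (proots (char_poly A)) = n"
    using as(2) by (simp add: proots bs)
  show "char_poly A = (\<Prod>a\<in>#proots (char_poly A). [:- a, 1:])"
    unfolding proots by (subst fac) (simp add: prod_mset_prod_list flip: mset_map)
qed

text \<open>The bound comes from reading the eigenvector equation at a coordinate of largest
  absolute value.\<close>

lemma abs_eigenvalue_le_row_sum:
  fixes A :: "real mat"
  assumes A: "A \<in> carrier_mat n n"
    and row_sum: "\<And>i. i < n \<Longrightarrow> (\<Sum>j<n. \<bar>A $$ (i, j)\<bar>) \<le> s"
    and ev: "eigenvalue A k"
  shows "\<bar>k\<bar> \<le> s"
proof -
  obtain v where v: "v \<in> carrier_vec n" "v \<noteq> 0\<^sub>v n" and Av: "A *\<^sub>v v = k \<cdot>\<^sub>v v"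
    using ev A unfolding eigenvalue_def eigenvector_def by auto
  from v have "n > 0"
    by (cases n) (auto simp: vec_eq_iff)
  define x where "x = Max ((\<lambda>i. \<bar>v $ i\<bar>) ` {..<n})"
  have x_ge: "\<bar>v $ i\<bar> \<le> x" if "i < n" for i
    using that by (auto simp: x_def)
  have "x \<in> (\<lambda>i. \<bar>v $ i\<bar>) ` {..<n}"
    unfolding x_def using \<open>n > 0\<close> by (intro Max_in) auto
  then obtain i where i: "i < n" "x = \<bar>v $ i\<bar>" by auto
  have "x > 0"
  proof -
    obtain j where "j < n" "v $ j \<noteq> 0"
      using v by (auto simp: vec_eq_iff)
    then show ?thesis using x_ge[of j] by linarith
  qed
  have "k * v $ i = (\<Sum>j<n. A $$ (i, j) * v $ j)"
    using i A v arg_cong[OF Av, of "\<lambda>w. w $ i"] by (simp add: scalar_prod_def lessThan_atLeast0)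
  then have "\<bar>k\<bar> * x = \<bar>\<Sum>j<n. A $$ (i, j) * v $ j\<bar>"
    by (simp add: i flip: abs_mult)
  also have "\<dots> \<le> (\<Sum>j<n. \<bar>A $$ (i, j)\<bar> * x)"
    by (rule order_trans[OF sum_abs]) (auto simp: abs_mult intro!: sum_mono mult_left_mono x_ge)
  also have "\<dots> \<le> s * x"
    using row_sum[OF i(1)] \<open>x > 0\<close> by (simp flip: sum_distrib_right)
  finally show ?thesis
    using \<open>x > 0\<close> by simp
qed

text \<open>The determinant is a scaled value of the characteristic polynomial at
  \<open>- \<alpha> / \<beta>\<close>, which splits into linear factors; the scalar case
  \<open>\<beta> = 0\<close> needs only the number of roots.\<close>

lemma det_affine_eq_prod_proots:
  fixes A :: "real mat"
  assumes A: "A \<in> carrier_mat n n" and sym: "transpose_mat A = A"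
  shows "det (\<alpha> \<cdot>\<^sub>m 1\<^sub>m n + \<beta> \<cdot>\<^sub>m A) = (\<Prod>a\<in>#proots (char_poly A). \<alpha> + \<beta> * a)"
proof (cases "\<beta> = 0")
  case True
  have "\<alpha> \<cdot>\<^sub>m 1\<^sub>m n + \<beta> \<cdot>\<^sub>m A = \<alpha> \<cdot>\<^sub>m 1\<^sub>m n"
    using A True by auto
  then show ?thesis
    using True symmetric_real_mat_char_poly_splits(1)[OF A sym] by simp
next
  case False
  have poly_prod: "poly (\<Prod>a\<in>#M. [:- a, 1:]) x = (\<Prod>a\<in>#M. x - a)" for M and x :: real
    by (induction M) (auto simp: algebra_simps)
  \<comment> \<open>\<open>- char_matrix A k\<close> is \<open>k I - A\<close>, whose determinant is
    the characteristic polynomial at \<open>k\<close>.\<close>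
  have "\<alpha> \<cdot>\<^sub>m 1\<^sub>m n + \<beta> \<cdot>\<^sub>m A = (- \<beta>) \<cdot>\<^sub>m (- char_matrix A (- \<alpha> / \<beta>))"
    using A False by (auto simp: char_matrix_def field_simps)
  then have "det (\<alpha> \<cdot>\<^sub>m 1\<^sub>m n + \<beta> \<cdot>\<^sub>m A) = (- \<beta>) ^ n * poly (char_poly A) (- \<alpha> / \<beta>)"
    using A by (simp add: char_poly_matrix[OF A] char_matrix_def)
  also have "poly (char_poly A) (- \<alpha> / \<beta>) = (\<Prod>a\<in>#proots (char_poly A). - \<alpha> / \<beta> - a)"
    by (subst symmetric_real_mat_char_poly_splits(2)[OF A sym]) (rule poly_prod)
  also have "(- \<beta>) ^ n = (\<Prod>a\<in>#proots (char_poly A). - \<beta>)"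
    using symmetric_real_mat_char_poly_splits(1)[OF A sym] by simp
  also have "\<dots> * (\<Prod>a\<in>#proots (char_poly A). - \<alpha> / \<beta> - a) =
      (\<Prod>a\<in>#proots (char_poly A). - \<beta> * (- \<alpha> / \<beta> - a))"
    by (simp only: prod_mset.distrib)
  also have "\<dots> = (\<Prod>a\<in>#proots (char_poly A). \<alpha> + \<beta> * a)"
    using False by (intro arg_cong[where f = prod_mset] image_mset_cong) (simp add: field_simps)
  finally show ?thesis .
qed

section \<open>Degrees and incidences in the graph and its central graph\<close>

lemma finite_edges:
  assumes "pair_graph G"
  shows "finite (edges G)"
proof -
  interpret pair_graph G by fact
  show ?thesis
    unfolding edges_def using pair_finite_arcs by simp
qed

lemma vertex_list:
  assumes "pair_graph G"
  shows "distinct (vertex_list G)" and "set (vertex_list G) = pverts G"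
    and "length (vertex_list G) = card (pverts G)"
proof -
  interpret pair_graph G by fact
  have "\<exists>vs. distinct vs \<and> set vs = pverts G"
    using finite_distinct_list[OF pair_finite_verts] by blast
  then have "distinct (vertex_list G) \<and> set (vertex_list G) = pverts G"
    unfolding vertex_list_def by (rule someI_ex)
  then show "distinct (vertex_list G)" "set (vertex_list G) = pverts G"
    by blast+
  then show "length (vertex_list G) = card (pverts G)"
    by (metis distinct_card)
qed

lemma vertex_degree_eq_card_neighbours:
  "vertex_degree G u = card {v. (u, v) \<in> parcs G}"
proof -
  have "out_arcs (with_proj G) u = Pair u ` {v. (u, v) \<in> parcs G}"
    by (auto simp: out_arcs_def)
  then show ?thesis
    by (simp add: vertex_degree_def out_degree_def card_image inj_on_def)
qed

text \<open>The map from a neighbour \<open>v\<close> to the edge \<open>{u, v}\<close> is a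
  bijection onto the edges at \<open>u\<close>.\<close>

lemma vertex_degree_eq_card_edges:
  assumes "pair_graph G"
  shows "vertex_degree G u = card {e \<in> edges G. u \<in> e}"
proof -
  interpret pair_graph G by fact
  have "{e \<in> edges G. u \<in> e} = (\<lambda>v. {u, v}) ` {v. (u, v) \<in> parcs G}"
    by (auto simp: edges_def insert_commute dest: arcs_symmetric intro: rev_image_eqI)
  moreover have "inj_on (\<lambda>v. {u, v}) {v. (u, v) \<in> parcs G}"
    by (auto simp: inj_on_def doubleton_eq_iff)
  ultimately show ?thesis
    by (simp add: vertex_degree_eq_card_neighbours card_image)
qed

lemma edges_through_two_vertices:
  assumes "pair_graph G" and "u \<noteq> v"
  shows "{e \<in> edges G. u \<in> e \<and> v \<in> e} = (if (u, v) \<in> parcs G then {{u, v}} else {})"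
proof -
  interpret pair_graph G by fact
  show ?thesis
    using assms(2) by (force simp: edges_def insert_commute dest: arcs_symmetric)
qed

lemma neighbours_subset:
  assumes "pair_graph G"
  shows "{v. (u, v) \<in> parcs G} \<subseteq> pverts G - {u}"
proof -
  interpret pair_graph G by fact
  show ?thesis
    using no_loops by (fastforce dest: in_arcsD2)
qed

lemma vertex_degree_less_card:
  assumes "pair_graph G" and "u \<in> pverts G"
  shows "vertex_degree G u < card (pverts G)"
proof -
  interpret pair_graph G by fact
  have "vertex_degree G u \<le> card (pverts G - {u})"
    unfolding vertex_degree_eq_card_neighbours
    using neighbours_subset[OF assms(1)] pair_finite_verts by (intro card_mono) auto
  also have "\<dots> < card (pverts G)"
    using assms(2) pair_finite_verts by (intro psubset_card_mono) auto
  finally show ?thesis .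
qed

text \<open>Each neighbour of \<open>u\<close> is replaced by the vertex subdividing the edge to it,
  and each non-neighbour becomes adjacent, so every other original vertex is counted exactly
  once.\<close>

lemma vertex_degree_central_graph_Inl:
  assumes "pair_graph G" and u: "u \<in> pverts G"
  shows "vertex_degree (central_graph G) (Inl u) = card (pverts G) - 1"
proof -
  interpret pair_graph G by fact
  let ?N = "{v. (u, v) \<in> parcs G}" and ?E = "{e \<in> edges G. u \<in> e}"
  have fin: "finite (pverts G)" "finite ?N"
    using finite_subset[OF neighbours_subset[OF assms(1)]] pair_finite_verts by auto
  have "{x. (Inl u, x) \<in> parcs (central_graph G)} =
      Inr ` ?E \<union> Inl ` (pverts G - {u} - ?N)"
    using u by (auto simp: central_graph_def)
  also have "card \<dots> = card ?E + card (pverts G - {u} - ?N)"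
    using finite_edges[OF assms(1)] fin
    by (subst card_Un_disjoint) (auto simp: card_image)
  also have "card ?E = card ?N"
    by (simp flip: vertex_degree_eq_card_edges[OF assms(1)] vertex_degree_eq_card_neighbours)
  also have "card ?N + card (pverts G - {u} - ?N) = card (pverts G - {u})"
    using fin neighbours_subset[OF assms(1), of u]
    by (subst card_Diff_subset) (auto intro!: le_add_diff_inverse card_mono)
  finally show ?thesis
    using u fin by (simp add: vertex_degree_eq_card_neighbours)
qed

lemma vertex_degree_central_graph_Inr:
  assumes "pair_graph G" and e: "e \<in> edges G"
  shows "vertex_degree (central_graph G) (Inr e) = 2"
proof -
  interpret pair_graph G by fact
  have "{x. (Inr e, x) \<in> parcs (central_graph G)} = Inl ` e"
    using e by (auto simp: central_graph_def)
  moreover have "card e = 2"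
    using e no_loops by (fastforce simp: edges_def card_2_iff)
  ultimately show ?thesis
    by (simp add: vertex_degree_eq_card_neighbours card_image)
qed

section \<open>Matrices of the graph and their spectra\<close>

text \<open>Entries written as a function of two vertices, rather than of two indices, are what
  \<open>det_mat_mset_eq\<close> can reorder.\<close>

lemma normalized_laplacian_eq_mat:
  assumes "pair_graph H"
  shows "normalized_laplacian H =
    mat (length (vertex_list H)) (length (vertex_list H))
      (\<lambda>(i, j). (\<lambda>x y. (if x = y then 1 else 0) -
          (if (x, y) \<in> parcs H
           then 1 / sqrt (vertex_degree H x) * (1 / sqrt (vertex_degree H y)) else 0))
        (vertex_list H ! i) (vertex_list H ! j))"
proof -
  have A: "adjacency_matrix H \<in> carrier_mat (card (pverts H)) (card (pverts H))"
    by (simp add: adjacency_matrix_def)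
  show ?thesis
    unfolding normalized_laplacian_def inv_sqrt_degree_matrix_def
      mat_diag_mult_left[OF A]
    by (subst mat_diag_mult_right[of _ "card (pverts H)"])
      (auto simp: adjacency_matrix_def vertex_list[OF assms] nth_eq_iff_index_eq)
qed

lemma adjacency_matrix_carrier:
  "adjacency_matrix G \<in> carrier_mat (card (pverts G)) (card (pverts G))"
  by (simp add: adjacency_matrix_def)

lemma transpose_adjacency_matrix:
  assumes "pair_graph G"
  shows "transpose_mat (adjacency_matrix G) = adjacency_matrix G"
proof -
  interpret pair_graph G by fact
  show ?thesis
    by (rule eq_matI) (auto simp: adjacency_matrix_def dest: arcs_symmetric)
qed

lemma sum_nth_distinct:
  assumes "distinct xs"
  shows "(\<Sum>k<length xs. f (xs ! k)) = sum f (set xs)"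
  using assms
  by (metis (no_types, lifting) atLeast0LessThan sum_list_distinct_conv_sum_set sum_list_sum_nth
      length_map nth_map sum.cong lessThan_iff)

lemma adjacency_matrix_row_sum:
  assumes "pair_graph G" and "i < card (pverts G)"
  shows "(\<Sum>j<card (pverts G). adjacency_matrix G $$ (i, j)) = vertex_degree G (vertex_list G ! i)"
proof -
  interpret pair_graph G by fact
  let ?u = "vertex_list G ! i"
  have "(\<Sum>j<card (pverts G). adjacency_matrix G $$ (i, j)) =
      (\<Sum>j<length (vertex_list G). if (?u, vertex_list G ! j) \<in> parcs G then 1 else 0)"
    using assms by (simp add: adjacency_matrix_def vertex_list)
  also have "\<dots> = (\<Sum>v\<in>pverts G. if (?u, v) \<in> parcs G then 1 else 0)"
    using vertex_list[OF assms(1)] by (subst sum_nth_distinct) auto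
  also have "\<dots> = card {v \<in> pverts G. (?u, v) \<in> parcs G}"
    using pair_finite_verts by (simp flip: sum.inter_filter)
  also have "{v \<in> pverts G. (?u, v) \<in> parcs G} = {v. (?u, v) \<in> parcs G}"
    by (auto dest: in_arcsD2)
  finally show ?thesis
    by (simp add: vertex_degree_eq_card_neighbours)
qed

text \<open>Rows follow \<open>vertex_list G\<close>, so that the product with the transpose can be
  compared with \<open>adjacency_matrix G\<close> entry by entry.\<close>

definition incidence_matrix :: "'a pair_pre_digraph \<Rightarrow> 'a set list \<Rightarrow> real mat" where
  "incidence_matrix G es =
     mat (card (pverts G)) (length es) (\<lambda>(i, j). if vertex_list G ! i \<in> es ! j then 1 else 0)"

text \<open>An entry of the product counts the edges containing both vertices: the degree
  \<open>r\<close> on the diagonal, and elsewhere 1 or 0 by adjacency, because the graph is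
  simple.\<close>

lemma incidence_matrix_mult_transpose:
  assumes G: "pair_graph G" and reg: "regular r G" and es: "distinct es" "set es = edges G"
  shows "incidence_matrix G es * transpose_mat (incidence_matrix G es) =
    adjacency_matrix G + of_nat r \<cdot>\<^sub>m 1\<^sub>m (card (pverts G))"
proof (rule eq_matI)
  let ?n = "card (pverts G)"
  fix i j assume "i < dim_row (adjacency_matrix G + of_nat r \<cdot>\<^sub>m 1\<^sub>m ?n)"
    "j < dim_col (adjacency_matrix G + of_nat r \<cdot>\<^sub>m 1\<^sub>m ?n)"
  then have ij: "i < ?n" "j < ?n"
    by (auto simp: adjacency_matrix_def)
  let ?u = "vertex_list G ! i" and ?v = "vertex_list G ! j"
  have u: "?u \<in> pverts G"
    using ij vertex_list[OF G] by (metis nth_mem)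
  have "(incidence_matrix G es * transpose_mat (incidence_matrix G es)) $$ (i, j) =
      (\<Sum>k<length es. if ?u \<in> es ! k \<and> ?v \<in> es ! k then 1 else 0)"
    using ij by (auto simp: incidence_matrix_def scalar_prod_def lessThan_atLeast0 intro!: sum.cong)
  also have "\<dots> = (\<Sum>e\<in>edges G. if ?u \<in> e \<and> ?v \<in> e then 1 else 0)"
    using es by (subst sum_nth_distinct) auto
  also have "\<dots> = card {e \<in> edges G. ?u \<in> e \<and> ?v \<in> e}"
    using finite_edges[OF G] by (simp flip: sum.inter_filter)
  also have "\<dots> = (adjacency_matrix G + of_nat r \<cdot>\<^sub>m 1\<^sub>m ?n) $$ (i, j)"
  proof (cases "i = j")
    case True
    moreover have "(?u, ?u) \<notin> parcs G"
      using neighbours_subset[OF G, of ?u] by auto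
    moreover have "card {e \<in> edges G. ?u \<in> e} = r"
      using reg u by (simp add: regular_def flip: vertex_degree_eq_card_edges[OF G])
    ultimately show ?thesis
      using ij by (simp add: adjacency_matrix_def)
  next
    case False
    then have "?u \<noteq> ?v"
      using ij vertex_list[OF G] by (simp add: nth_eq_iff_index_eq)
    then show ?thesis
      using ij False edges_through_two_vertices[OF G] by (simp add: adjacency_matrix_def)
  qed
  finally show "(incidence_matrix G es * transpose_mat (incidence_matrix G es)) $$ (i, j) =
      (adjacency_matrix G + of_nat r \<cdot>\<^sub>m 1\<^sub>m ?n) $$ (i, j)" .
qed (auto simp: incidence_matrix_def adjacency_matrix_def)

text \<open>The all-ones vector is an eigenvector for \<open>r\<close>, and the absolute row sums
  equal \<open>r\<close>. The upper bound identifies \<open>r\<close> as the greatest eigenvalue;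
  the lower bound later makes the roots of the quadratics positive.\<close>

lemma adjacency_proots_regular:
  assumes G: "pair_graph G" and reg: "regular r G" and ne: "pverts G \<noteq> {}"
  shows "real r \<in># proots (char_poly (adjacency_matrix G))"
    and "\<And>l. l \<in># proots (char_poly (adjacency_matrix G)) \<Longrightarrow> \<bar>l\<bar> \<le> real r"
proof -
  interpret pair_graph G by fact
  let ?n = "card (pverts G)" and ?A = "adjacency_matrix G"
  note A = adjacency_matrix_carrier[of G]
  have nz: "char_poly ?A \<noteq> 0"
    using degree_monic_char_poly[OF A] by auto
  have row: "(\<Sum>j<?n. ?A $$ (i, j)) = real r" if "i < ?n" for i
    using that reg adjacency_matrix_row_sum[OF G that] vertex_list[OF G]
    by (metis nth_mem regular_def)
  have "?n > 0"
    using ne pair_finite_verts by (simp add: card_gt_0_iff)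
  have "?A *\<^sub>v vec ?n (\<lambda>_. 1) = real r \<cdot>\<^sub>v vec ?n (\<lambda>_. 1)"
    using A row by (auto simp: scalar_prod_def lessThan_atLeast0)
  moreover have "vec ?n (\<lambda>_. 1 :: real) \<noteq> 0\<^sub>v ?n"
    using \<open>?n > 0\<close> by (auto simp: vec_eq_iff)
  ultimately have "eigenvalue ?A (real r)"
    using A unfolding eigenvalue_def eigenvector_def by (intro exI[of _ "vec ?n (\<lambda>_. 1)"]) auto
  then show "real r \<in># proots (char_poly ?A)"
    using nz by (simp add: eigenvalue_root_char_poly[OF A])
  fix l assume "l \<in># proots (char_poly ?A)"
  then have "eigenvalue ?A l"
    using nz by (simp add: eigenvalue_root_char_poly[OF A])
  moreover have "(\<Sum>j<?n. \<bar>?A $$ (i, j)\<bar>) \<le> real r" if "i < ?n" for i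
  proof -
    have "(\<Sum>j<?n. \<bar>?A $$ (i, j)\<bar>) = (\<Sum>j<?n. ?A $$ (i, j))"
      using that by (intro sum.cong) (auto simp: adjacency_matrix_def)
    then show ?thesis using row[OF that] by simp
  qed
  ultimately show "\<bar>l\<bar> \<le> real r"
    using abs_eigenvalue_le_row_sum[OF A] by blast
qed

lemma normalized_laplacian_carrier:
  "normalized_laplacian H \<in> carrier_mat (card (pverts H)) (card (pverts H))"
  by (rule carrier_matI)
    (simp_all add: normalized_laplacian_def inv_sqrt_degree_matrix_def mat_diag_def)

lemma card_pverts_central_graph:
  assumes "pair_graph G"
  shows "card (pverts (central_graph G)) = card (pverts G) + card (edges G)"
proof -
  interpret pair_graph G by fact
  show ?thesis
    using finite_edges[OF assms] pair_finite_verts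
    by (simp add: central_graph_def) (subst card_Un_disjoint, auto simp: card_image)
qed

section \<open>Characteristic polynomial of the central graph\<close>

text \<open>With original vertices first, the degrees \<open>t\<close> and 2 give weight
  \<open>1 / t\<close> to arcs between original vertices, described by the complement matrix
  \<open>J - I - A\<close>, and weight \<open>1 / sqrt (2 * t)\<close> to incidences. Subdividing
  vertices are pairwise non-adjacent, which makes the last block scalar.\<close>

lemma char_poly_normalized_laplacian_central_graph_block:
  fixes k :: real
  assumes G: "pair_graph G" and n: "card (pverts G) = n" "n \<ge> 2"
    and es: "distinct es" "set es = edges G"
  defines "y \<equiv> k - 1" and "t \<equiv> real n - 1"
  shows "poly (char_poly (normalized_laplacian (central_graph G))) k =
    det (four_block_mat
      (y \<cdot>\<^sub>m 1\<^sub>m n + (1 / t) \<cdot>\<^sub>m (mat n n (\<lambda>_. 1) - 1\<^sub>m n - adjacency_matrix G))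
      (1 / sqrt (2 * t) \<cdot>\<^sub>m incidence_matrix G es)
      (1 / sqrt (2 * t) \<cdot>\<^sub>m transpose_mat (incidence_matrix G es))
      (y \<cdot>\<^sub>m 1\<^sub>m (length es)))"
proof -
  let ?H = "central_graph G" and ?vs = "vertex_list G"
  note H = pair_graph_central_graph[OF G]
  note vs = vertex_list[OF G] and vsH = vertex_list[OF H]
  \<comment> \<open>\<open>f\<close> gives the entries of \<open>k I - L\<close>: subtracting the
    Laplacian turns the weight of an arc positive.\<close>
  define f where "f = (\<lambda>x y. (if x = y then k - 1 else 0) +
    (if (x, y) \<in> parcs ?H
     then 1 / sqrt (vertex_degree ?H x) * (1 / sqrt (vertex_degree ?H y)) else 0))"
  define xs where "xs = map Inl ?vs @ map Inr es"
  have "poly (char_poly (normalized_laplacian ?H)) k =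
      det (- char_matrix (normalized_laplacian ?H) k)"
    by (rule char_poly_matrix[OF normalized_laplacian_carrier])
  also have "- char_matrix (normalized_laplacian ?H) k =
      mat (length (vertex_list ?H)) (length (vertex_list ?H))
        (\<lambda>(i, j). f (vertex_list ?H ! i) (vertex_list ?H ! j))"
    unfolding normalized_laplacian_eq_mat[OF H]
    by (rule eq_matI) (auto simp: char_matrix_def f_def nth_eq_iff_index_eq vsH)
  also have "det \<dots> = det (mat (length xs) (length xs) (\<lambda>(i, j). f (xs ! i) (xs ! j)))"
  proof (rule det_mat_mset_eq)
    have "distinct xs" "set xs = set (vertex_list ?H)"
      unfolding vsH(2) using vs es by (auto simp: xs_def distinct_map central_graph_def)
    then show "mset (vertex_list ?H) = mset xs"
      using vsH by (metis set_eq_iff_mset_eq_distinct)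
  qed
  also have "mat (length xs) (length xs) (\<lambda>(i, j). f (xs ! i) (xs ! j)) = four_block_mat
      (y \<cdot>\<^sub>m 1\<^sub>m n + (1 / t) \<cdot>\<^sub>m (mat n n (\<lambda>_. 1) - 1\<^sub>m n - adjacency_matrix G))
      (1 / sqrt (2 * t) \<cdot>\<^sub>m incidence_matrix G es)
      (1 / sqrt (2 * t) \<cdot>\<^sub>m transpose_mat (incidence_matrix G es))
      (y \<cdot>\<^sub>m 1\<^sub>m (length es))" (is "?L = ?R")
  proof (rule eq_matI)
    have len: "length ?vs = n" and t: "t = real (n - 1)" "t > 0"
      using vs n by (auto simp: t_def)
    have lenxs: "length xs = n + length es"
      by (simp add: xs_def len)
    show "dim_row ?L = dim_row ?R" "dim_col ?L = dim_col ?R"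
      by (simp_all add: lenxs adjacency_matrix_def n)
    have V: "?vs ! i \<in> pverts G" if "i < n" for i
      using that vs len by (metis nth_mem)
    have E: "es ! i \<in> edges G" if "i < length es" for i
      using that es by (metis nth_mem)
    have dV: "vertex_degree ?H (Inl (?vs ! i)) = n - 1" if "i < n" for i
      using vertex_degree_central_graph_Inl[OF G V[OF that]] n by simp
    have dE: "vertex_degree ?H (Inr (es ! i)) = 2" if "i < length es" for i
      using vertex_degree_central_graph_Inr[OF G E[OF that]] .
    have arcs:
      "(Inl u, Inl v) \<in> parcs ?H \<longleftrightarrow> u \<in> pverts G \<and> v \<in> pverts G \<and> u \<noteq> v \<and> (u, v) \<notin> parcs G"
      "(Inl u, Inr e) \<in> parcs ?H \<longleftrightarrow> e \<in> edges G \<and> u \<in> e"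
      "(Inr e, Inl u) \<in> parcs ?H \<longleftrightarrow> e \<in> edges G \<and> u \<in> e"
      "(Inr e, Inr e') \<notin> parcs ?H" for u v e e'
      by (auto simp: central_graph_def)
    have noloop: "(u, u) \<notin> parcs G" for u
      using neighbours_subset[OF G, of u] by auto
    fix i j assume "i < dim_row ?R" "j < dim_col ?R"
    then have ij: "i < n + length es" "j < n + length es"
      by (auto simp: adjacency_matrix_def n)
    then have L: "?L $$ (i, j) = f (xs ! i) (xs ! j)"
      by (simp add: lenxs)
    have xs_nth: "xs ! i = (if i < n then Inl (?vs ! i) else Inr (es ! (i - n)))"
      if "i < n + length es" for i
      using that by (auto simp: xs_def nth_append len)
    consider "i < n" "j < n" | "i < n" "\<not> j < n" | "\<not> i < n" "j < n" | "\<not> i < n" "\<not> j < n"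
      by blast
    then show "?L $$ (i, j) = ?R $$ (i, j)"
    proof cases
      case 1
      have "?vs ! i = ?vs ! j \<longleftrightarrow> i = j"
        using 1 vs len by (simp add: nth_eq_iff_index_eq)
      then show ?thesis
        unfolding L using 1 ij V noloop t(2)
        by (auto simp: xs_nth f_def arcs dV adjacency_matrix_def n y_def simp flip: t(1) t_def)
    next
      case 2
      then show ?thesis
        unfolding L using ij E[of "j - n"]
        by (auto simp: xs_nth f_def arcs dV dE incidence_matrix_def adjacency_matrix_def n
            real_sqrt_mult simp flip: t(1) t_def)
    next
      case 3
      then show ?thesis
        unfolding L using ij E[of "i - n"]
        by (auto simp: xs_nth f_def arcs dV dE incidence_matrix_def adjacency_matrix_def n
            real_sqrt_mult simp flip: t(1) t_def)
    next
      case 4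
      then have "es ! (i - n) = es ! (j - n) \<longleftrightarrow> i = j"
        using ij es by (auto simp: nth_eq_iff_index_eq)
      with 4 show ?thesis
        unfolding L using ij
        by (auto simp: xs_nth f_def arcs adjacency_matrix_def n y_def)
    qed
  qed
  finally show ?thesis .
qed

text \<open>
  The quadratic contributed to the characteristic polynomial in the variable \<open>x\<close> by an adjacency
  eigenvalue \<open>l\<close>, where \<open>t = n - 1\<close>; in \<open>y = x - 1\<close> it is
  \<open>y\<^sup>2 - y (1 + l) / t - (l + r) / (2 t)\<close>.
\<close>

definition central_factor :: "real \<Rightarrow> real \<Rightarrow> real \<Rightarrow> real poly" where
  "central_factor t r l = [:1 + (1 + l) / t - (l + r) / (2 * t), - 2 - (1 + l) / t, 1:]"

text \<open>The polynomials are compared at every real \<open>k\<close>. Removing the all-ones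
  matrix costs a factor \<open>s\<close>, the value of \<open>central_factor t r r\<close>, which
  may vanish at some \<open>k\<close>; hence both sides carry this factor, and it is cancelled as a
  nonzero polynomial.\<close>

lemma char_poly_normalized_laplacian_central_graph:
  assumes G: "pair_graph G" and reg: "regular r G"
    and n: "card (pverts G) = n" "n \<ge> 2" and m: "card (edges G) = m"
  defines "t \<equiv> real n - 1"
  shows "char_poly (normalized_laplacian (central_graph G)) * [:- 1, 1:] ^ n =
    [:- 1, 1:] ^ m * ([:0, 1:] * [:- (1 + r / t), 1:] *
      (\<Prod>l\<in>#proots (char_poly (adjacency_matrix G)) - {#real r#}. central_factor t r l))"
    (is "?\<chi> * _ = _")
proof -
  let ?A = "adjacency_matrix G"
  have t: "t > 0" and tn: "real n = t + 1"
    using n by (auto simp: t_def)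
  have A: "?A \<in> carrier_mat n n"
    using adjacency_matrix_carrier[of G] n by simp
  obtain es where es: "distinct es" "set es = edges G"
    using finite_distinct_list[OF finite_edges[OF G]] by blast
  have len: "length es = m"
    using es m distinct_card by fastforce
  let ?B = "incidence_matrix G es" and ?c = "1 / sqrt (2 * t)"
  have B: "?B \<in> carrier_mat n m"
    by (simp add: incidence_matrix_def n len)
  define R where "R = proots (char_poly ?A) - {#real r#}"
  have "pverts G \<noteq> {}"
    using n by auto
  then have proots: "proots (char_poly ?A) = add_mset (real r) R"
    using adjacency_proots_regular(1)[OF G reg] by (simp add: R_def)
  have "central_factor t r r * (?\<chi> * [:- 1, 1:] ^ n) =
      central_factor t r r * ([:- 1, 1:] ^ m * ([:0, 1:] * [:- (1 + r / t), 1:] *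
      (\<Prod>l\<in>#R. central_factor t r l)))"
  proof (rule poly_ext)
    fix k :: real
    define y where "y = k - 1"
    \<comment> \<open>\<open>\<alpha>\<close> and \<open>\<beta>\<close> are the coefficients of
      \<open>I\<close> and \<open>A\<close> in the Schur complement; the coefficient of
      \<open>J\<close> is \<open>y / t\<close>.\<close>
    define \<alpha> where "\<alpha> = y\<^sup>2 - y / t - r / (2 * t)"
    define \<beta> where "\<beta> = - y / t - 1 / (2 * t)"
    define s where "s = \<alpha> + \<beta> * r"
    let ?C = "\<alpha> \<cdot>\<^sub>m 1\<^sub>m n + \<beta> \<cdot>\<^sub>m ?A"
    have factor: "poly (central_factor t r l) k = \<alpha> + \<beta> * l" for l
      using t by (simp add: central_factor_def \<alpha>_def \<beta>_def y_def field_simps power2_eq_square)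
    have k: "poly [:- 1, 1:] k = y"
      by (simp add: y_def)
    let ?P = "y \<cdot>\<^sub>m 1\<^sub>m n + (1 / t) \<cdot>\<^sub>m (mat n n (\<lambda>_. 1) - 1\<^sub>m n - ?A)"
    have BB: "(?c \<cdot>\<^sub>m ?B) * (?c \<cdot>\<^sub>m transpose_mat ?B) = (1 / (2 * t)) \<cdot>\<^sub>m (?A + of_nat r \<cdot>\<^sub>m 1\<^sub>m n)"
    proof -
      have "(?c \<cdot>\<^sub>m ?B) * (?c \<cdot>\<^sub>m transpose_mat ?B) = (?c * ?c) \<cdot>\<^sub>m (?B * transpose_mat ?B)"
        using B by (auto simp: mult_smult_assoc_mat[of _ n m _ n] mult_smult_distrib[of _ n m _ n])
      also have "?c * ?c = 1 / (2 * t)"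
        using t by simp
      finally show ?thesis
        using incidence_matrix_mult_transpose[OF G reg es] n by simp
    qed
    have "poly ?\<chi> k * y ^ n = det (y \<cdot>\<^sub>m ?P - (?c \<cdot>\<^sub>m ?B) * (?c \<cdot>\<^sub>m transpose_mat ?B)) * y ^ m"
      unfolding char_poly_normalized_laplacian_central_graph_block[OF G n es, of k] y_def[symmetric]
        t_def[symmetric] len
      by (rule det_four_block_scalar_lower_right) (use A B in auto)
    also have "y \<cdot>\<^sub>m ?P - (?c \<cdot>\<^sub>m ?B) * (?c \<cdot>\<^sub>m transpose_mat ?B) = ?C + mat n n (\<lambda>_. y / t)"
      unfolding BB using A t
      by (intro eq_matI) (auto simp: \<alpha>_def \<beta>_def algebra_simps add_divide_distrib diff_divide_distrib
          power2_eq_square)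
    finally have \<chi>: "poly ?\<chi> k * y ^ n = det (?C + mat n n (\<lambda>_. y / t)) * y ^ m" .
    have row: "(\<Sum>j<n. ?C $$ (i, j)) = s" if "i < n" for i
    proof -
      have "(\<Sum>j<n. ?A $$ (i, j)) = r"
        using that reg adjacency_matrix_row_sum[OF G] vertex_list[OF G] n
        by (metis nth_mem regular_def)
      moreover have "(\<Sum>j<n. ?C $$ (i, j)) =
          (\<Sum>j<n. (if i = j then \<alpha> else 0) + \<beta> * ?A $$ (i, j))"
        using that A by (intro sum.cong) auto
      ultimately show ?thesis
        using that by (simp add: sum.distrib s_def flip: sum_distrib_left)
    qed
    have "s * det (?C + mat n n (\<lambda>_. y / t)) = (s + y / t * n) * det ?C"
      by (rule det_add_const_mat) (use A row in auto)
    also have "det ?C = s * (\<Prod>l\<in>#R. \<alpha> + \<beta> * l)"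
      using transpose_adjacency_matrix[OF G]
      by (simp add: det_affine_eq_prod_proots[OF A] proots s_def)
    \<comment> \<open>The two linear factors, in \<open>y = k - 1\<close>, account for the
      eigenvalues 0 and \<open>1 + r / t\<close>; they replace the quadratic of the eigenvalue
      \<open>r\<close>.\<close>
    also have "s + y / t * n = (y + 1) * (y - r / t)"
      using t by (simp add: s_def \<alpha>_def \<beta>_def tn field_simps power2_eq_square)
    finally have det: "s * det (?C + mat n n (\<lambda>_. y / t)) =
        (y + 1) * (y - r / t) * (s * (\<Prod>l\<in>#R. \<alpha> + \<beta> * l))" .
    have prod: "poly (\<Prod>l\<in>#M. central_factor t r l) k = (\<Prod>l\<in>#M. \<alpha> + \<beta> * l)" for M
      by (induction M) (simp_all add: factor)
    have lin: "poly [:0, 1:] k = y + 1" "poly [:- (1 + r / t), 1:] k = y - r / t"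
      by (simp_all add: y_def)
    have "s * (det (?C + mat n n (\<lambda>_. y / t)) * y ^ m) =
        y ^ m * (s * det (?C + mat n n (\<lambda>_. y / t)))"
      by simp
    then show "poly (central_factor t r r * (?\<chi> * [:- 1, 1:] ^ n)) k =
        poly (central_factor t r r * ([:- 1, 1:] ^ m * ([:0, 1:] * [:- (1 + r / t), 1:] *
          (\<Prod>l\<in>#R. central_factor t r l)))) k"
      unfolding poly_mult poly_power factor k \<chi> s_def[symmetric] det prod lin
      by (simp only: mult_ac)
  qed
  moreover have "central_factor t r r \<noteq> 0"
    by (simp add: central_factor_def)
  ultimately show ?thesis
    unfolding R_def by (simp only: mult_cancel_left simp_thms)
qed

section \<open>Roots of the quadratic factors\<close>

text \<open>The roots are \<open>(s + d) / 2\<close> and \<open>(s - d) / 2\<close> with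
  \<open>d\<close> the square root of the discriminant; \<open>p > 0\<close> forces
  \<open>d < s\<close>.\<close>

lemma real_roots_positive:
  fixes p s :: real
  assumes "s > 0" "p > 0" "s\<^sup>2 \<ge> 4 * p"
  obtains a b where "a > 0" "b > 0" "a + b = s" "a * b = p"
proof
  define d where "d = sqrt (s\<^sup>2 - 4 * p)"
  have d2: "d\<^sup>2 = s\<^sup>2 - 4 * p" and d: "d \<ge> 0"
    using assms by (simp_all add: d_def)
  have "d < s"
    using d2 assms by (intro power_less_imp_less_base[of d 2]) auto
  then show "(s + d) / 2 > 0" "(s - d) / 2 > 0"
    using d by simp_all
  show "(s + d) / 2 + (s - d) / 2 = s"
    by (simp add: field_simps)
  show "(s + d) / 2 * ((s - d) / 2) = p"
    using d2 by (simp add: field_simps power2_eq_square)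
qed

text \<open>By Vieta the sum of the reciprocals is \<open>?s / ?p\<close>. The bounds
  \<open>r \<le> t\<close> and \<open>- r \<le> l\<close> make both numerators in \<open>s\<close>
  and \<open>p\<close> positive.\<close>

lemma proots_central_factor:
  fixes t r l :: real
  assumes "t \<ge> 1" "r \<ge> 0" "r \<le> t" "- r \<le> l"
  obtains a b where "a > 0" "b > 0" "proots (central_factor t r l) = {#a, b#}"
    "1 / a + 1 / b = 2 * (2 * (t + 1) + l - 1) / (2 * (t + 1) + l - r)"
proof -
  let ?s = "2 + (1 + l) / t" and ?p = "1 + (1 + l) / t - (l + r) / (2 * t)"
  have t: "t > 0" using assms by simp
  have s: "?s = (2 * t + 1 + l) / t" and p: "?p = (2 * (t + 1) + l - r) / (2 * t)"
    using t by (simp_all add: field_simps)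
  then have pos: "?s > 0" "?p > 0"
    using assms t by simp_all
  \<comment> \<open>The discriminant is a square plus a nonnegative multiple of
    \<open>l + r\<close>.\<close>
  have "?s\<^sup>2 - 4 * ?p = ((1 + l) / t)\<^sup>2 + 2 * ((l + r) / t)"
    using t by (simp add: field_simps power2_eq_square)
  also have "\<dots> \<ge> 0"
    using assms t by simp
  finally have "?s\<^sup>2 \<ge> 4 * ?p" by simp
  then obtain a b where ab: "a > 0" "b > 0" "a + b = ?s" "a * b = ?p"
    using real_roots_positive[OF pos] by blast
  have "central_factor t r l = [:- a, 1:] * [:- b, 1:]"
    using ab(3,4) by (simp add: central_factor_def mult.commute)
  then have "proots (central_factor t r l) = {#a, b#}"
    by (simp add: proots_mult del: mult_pCons_left mult_pCons_right)
  moreover have "1 / a + 1 / b = (a + b) / (a * b)"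
    using ab(1,2) by (simp add: field_simps)
  then have "1 / a + 1 / b = 2 * (2 * (t + 1) + l - 1) / (2 * (t + 1) + l - r)"
    unfolding ab(3) ab(4) s p using t by simp
  ultimately show ?thesis
    using that ab by blast
qed

lemma proots_prod_central_factor:
  fixes t r :: real
  assumes "t \<ge> 1" "r \<ge> 0" "r \<le> t" "\<And>l. l \<in># M \<Longrightarrow> - r \<le> l"
  defines "Z \<equiv> proots (\<Prod>l\<in>#M. central_factor t r l)"
  shows "size Z = 2 * size M" and "\<And>x. x \<in># Z \<Longrightarrow> x > 0"
    and "(\<Sum>x\<in>#Z. 1 / x) = (\<Sum>l\<in>#M. 2 * (2 * (t + 1) + l - 1) / (2 * (t + 1) + l - r))"
proof -
  have "size Z = 2 * size M \<and> (\<forall>x\<in>#Z. x > 0) \<and>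
    (\<Sum>x\<in>#Z. 1 / x) = (\<Sum>l\<in>#M. 2 * (2 * (t + 1) + l - 1) / (2 * (t + 1) + l - r))"
    unfolding Z_def using assms(4)
  proof (induction M)
    case (add l M)
    obtain a b where ab: "a > 0" "b > 0" "proots (central_factor t r l) = {#a, b#}"
      "1 / a + 1 / b = 2 * (2 * (t + 1) + l - 1) / (2 * (t + 1) + l - r)"
      using proots_central_factor[OF assms(1-3), of l] add.prems by auto
    have nz: "central_factor t r l \<noteq> 0" for l
      by (simp add: central_factor_def)
    have "proots (\<Prod>l\<in>#add_mset l M. central_factor t r l) =
        {#a, b#} + proots (\<Prod>l\<in>#M. central_factor t r l)"
      using ab(3) nz by (simp add: proots_mult prod_mset_zero_iff image_iff)
    then show ?case
      using add ab by auto
  qed simp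
  then show "size Z = 2 * size M" "\<And>x. x \<in># Z \<Longrightarrow> x > 0"
    "(\<Sum>x\<in>#Z. 1 / x) = (\<Sum>l\<in>#M. 2 * (2 * (t + 1) + l - 1) / (2 * (t + 1) + l - r))"
    by blast+
qed

section \<open>From sorted eigenvalue lists to multisets of roots\<close>

text \<open>Eigenvalues are numbered from 1 but lists from 0, so a sum starting at 2 omits exactly
  the head.\<close>

lemma sum_nth_tl:
  fixes f :: "'a \<Rightarrow> 'b :: comm_monoid_add"
  assumes "xs \<noteq> []"
  shows "(\<Sum>i = 2..length xs. f (xs ! (i - 1))) = (\<Sum>x\<in>#mset xs - {#hd xs#}. f x)"
proof (cases xs)
  case (Cons x ys)
  have "(\<Sum>i = 2..length xs. f (xs ! (i - 1))) = (\<Sum>i<length ys. f (ys ! i))"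
    by (rule sum.reindex_bij_witness[of _ "\<lambda>i. i + 2" "\<lambda>i. i - 2"])
      (auto simp: Cons nth_Cons' numeral_2_eq_2)
  also have "\<dots> = sum_list (map f ys)"
    by (simp add: sum_list_sum_nth lessThan_atLeast0)
  finally show ?thesis
    by (simp add: Cons sum_mset_sum_list flip: mset_map)
qed (use assms in simp)

lemma hd_sorted_eq_least:
  fixes x :: "'a :: linorder"
  assumes "sorted xs" "x \<in> set xs" "\<And>y. y \<in> set xs \<Longrightarrow> x \<le> y"
  shows "hd xs = x"
  using assms by (cases xs) (auto intro: antisym)

lemma hd_rev_sorted_eq_greatest:
  fixes x :: "'a :: linorder"
  assumes "sorted xs" "x \<in> set xs" "\<And>y. y \<in> set xs \<Longrightarrow> y \<le> x"
  shows "hd (rev xs) = x"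
  using assms by (cases xs rule: rev_cases) (auto simp: sorted_append intro: antisym)

text \<open>Sorting puts a root 0 first, so the defining sum omits one copy of it; this copy can be
  restored because \<open>1 / 0 = 0\<close>.\<close>

lemma kemeny_constant_eq_sum_proots:
  assumes "size (proots (char_poly (normalized_laplacian H))) = card (pverts H)"
    and "0 \<in># proots (char_poly (normalized_laplacian H))"
    and "\<And>x. x \<in># proots (char_poly (normalized_laplacian H)) \<Longrightarrow> x \<ge> 0"
  shows "kemeny_constant H = (\<Sum>x\<in>#proots (char_poly (normalized_laplacian H)). 1 / x)"
proof -
  let ?Z = "proots (char_poly (normalized_laplacian H))"
  define xs where "xs = sorted_list_of_multiset ?Z"
  have xs: "mset xs = ?Z" "sorted xs"
    by (simp_all add: xs_def)
  then have len: "length xs = card (pverts H)"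
    using assms(1) by (metis size_mset)
  have set: "set xs = set_mset ?Z"
    using xs(1) by (metis set_mset_mset)
  have "hd xs = 0"
    using assms(2,3) xs(2) by (intro hd_sorted_eq_least) (auto simp: set)
  moreover have "xs \<noteq> []"
    using assms(2) set by auto
  ultimately have "kemeny_constant H = (\<Sum>x\<in>#?Z - {#0#}. 1 / x)"
    using sum_nth_tl[of xs "\<lambda>x. 1 / x"]
    by (simp add: kemeny_constant_def normalized_laplacian_eigenvalue_def eigenvalue_list_def
        xs len flip: xs_def)
  also have "\<dots> = (\<Sum>x\<in>#add_mset 0 (?Z - {#0#}). 1 / x)"
    by simp
  finally show ?thesis
    using assms(2) by simp
qed

theorem theorem5p2:
  fixes G :: "'a pair_pre_digraph" and n m r :: nat
  assumes "pair_graph G"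
    and "regular r G"
    and "card (pverts G) = n"
    and "card (edges G) = m"
    and "n \<ge> 2"
  shows "kemeny_constant (central_graph G) =
    real m - real n + (real n - 1) / (real n - 1 + real r)
    + (\<Sum>i = 2..n. 2 * (2 * real n + adjacency_eigenvalue G i - 1)
                    / (2 * real n + adjacency_eigenvalue G i - real r))"
proof -
  note G = assms(1) and reg = assms(2)
  define t where "t = real n - 1"
  let ?H = "central_graph G" and ?A = "adjacency_matrix G"
  define Z where "Z = proots (char_poly (normalized_laplacian ?H))"
  define R where "R = proots (char_poly ?A) - {#real r#}"
  define W where "W = proots (\<Prod>l\<in>#R. central_factor t r l)"
  have t: "t \<ge> 1" and tn: "t + 1 = real n"
    using assms(5) by (auto simp: t_def)
  have ne: "pverts G \<noteq> {}"
    using assms(3,5) by auto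
  then obtain u where "u \<in> pverts G" by blast
  \<comment> \<open>This gives \<open>r \<le> t\<close>, which positivity of the roots of the
    quadratics requires.\<close>
  then have "r < n"
    using vertex_degree_less_card[OF G] reg assms(3) by (metis regular_def)
  then have rt: "real r \<le> t"
    by (simp add: t_def)
  note eig = adjacency_proots_regular[OF G reg ne]
  have A: "?A \<in> carrier_mat n n"
    using adjacency_matrix_carrier[of G] assms(3) by simp
  have size_A: "size (proots (char_poly ?A)) = n"
    using symmetric_real_mat_char_poly_splits(1)[OF A transpose_adjacency_matrix[OF G]] .
  have R_ge: "- real r \<le> l" if "l \<in># R" for l
    using eig(2)[of l] in_diffD[OF that[unfolded R_def]] by simp
  have W: "size W = 2 * size R" "\<And>x. x \<in># W \<Longrightarrow> x > 0"
    "(\<Sum>x\<in>#W. 1 / x) = (\<Sum>l\<in>#R. 2 * (2 * (t + 1) + l - 1) / (2 * (t + 1) + l - r))"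
    unfolding W_def
    by (rule proots_prod_central_factor[OF t of_nat_0_le_iff rt]; (erule R_ge | assumption))+
  have size_R: "size R = n - 1"
    using eig(1) size_A by (simp add: R_def size_Diff_singleton)
  have nz: "char_poly (normalized_laplacian ?H) \<noteq> 0"
    using degree_monic_char_poly[OF normalized_laplacian_carrier[of ?H]] by auto
  have nz': "central_factor t r l \<noteq> 0" for l
    by (simp add: central_factor_def)
  have "proots (char_poly (normalized_laplacian ?H) * [:- 1, 1:] ^ n) =
      proots ([:- 1, 1:] ^ m * ([:0, 1:] * [:- (1 + r / t), 1:] * (\<Prod>l\<in>#R. central_factor t r l)))"
    unfolding R_def t_def
    using char_poly_normalized_laplacian_central_graph[OF G reg assms(3,5,4)] by simp
  \<comment> \<open>Both powers of \<open>x - 1\<close> become copies of the root 1, each kept on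
    its own side so that no multiset is subtracted.\<close>
  then have ZW: "Z + replicate_mset n 1 = replicate_mset m 1 + ({#0, 1 + r / t#} + W)"
    using nz nz'
    by (simp add: proots_mult proots_power prod_mset_zero_iff image_iff Z_def W_def
        repeat_mset_replicate_mset del: mult_pCons_left mult_pCons_right)
  \<comment> \<open>Counting roots shows that all \<open>n + m\<close> eigenvalues of the normalized
    Laplacian are real.\<close>
  have "size Z + n = m + (2 + 2 * (n - 1))"
    using arg_cong[OF ZW, of size] by (simp add: W(1) size_R)
  then have size_Z: "size Z = card (pverts ?H)"
    using assms(3,4,5) by (simp add: card_pverts_central_graph[OF G])
  have "0 \<in># Z + replicate_mset n 1"
    unfolding ZW by simp
  then have zero: "0 \<in># Z" by (simp split: if_splits)
  have nonneg: "x \<ge> 0" if "x \<in># Z" for x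
  proof -
    have "x \<in># replicate_mset m 1 + ({#0, 1 + r / t#} + W)"
      using that unfolding ZW[symmetric] by simp
    then show ?thesis
      using t W(2)[of x] by (auto split: if_splits)
  qed
  \<comment> \<open>Each root 1 contributes 1, which yields the terms \<open>m\<close> and
    \<open>n\<close>; the root 0 contributes 0.\<close>
  have "(\<Sum>x\<in>#Z. 1 / x) + n = m + (1 / (1 + r / t) + (\<Sum>x\<in>#W. 1 / x))"
    using arg_cong[OF ZW, of "\<lambda>M. \<Sum>x\<in>#M. 1 / x"] by simp
  also have "1 / (1 + r / t) = t / (t + r)"
    using t by (simp add: field_simps)
  also have "(\<Sum>x\<in>#W. 1 / x) =
      (\<Sum>i = 2..n. 2 * (2 * real n + adjacency_eigenvalue G i - 1)
        / (2 * real n + adjacency_eigenvalue G i - real r))"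
  proof -
    define xs where "xs = sorted_list_of_multiset (proots (char_poly ?A))"
    have xs: "mset xs = proots (char_poly ?A)" "sorted xs"
      by (simp_all add: xs_def)
    have len: "length xs = n"
      using size_A xs(1) by (metis size_mset)
    have set: "set xs = set_mset (proots (char_poly ?A))"
      using xs(1) by (metis set_mset_mset)
    \<comment> \<open>The decreasing list starts with \<open>r\<close>, so the indices from 2 to
      \<open>n\<close> run through \<open>R\<close>.\<close>
    have "hd (rev xs) = real r"
    proof (rule hd_rev_sorted_eq_greatest[OF xs(2)])
      show "real r \<in> set xs"
        unfolding set by (rule eig(1))
      show "y \<le> real r" if "y \<in> set xs" for y
        using eig(2)[of y] that unfolding set by simp
    qed
    moreover have "rev xs \<noteq> []"
      using len assms(5) by auto
    ultimately have "(\<Sum>i = 2..n. f (adjacency_eigenvalue G i)) = (\<Sum>l\<in>#R. f l)"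
      for f :: "real \<Rightarrow> real"
      using sum_nth_tl[of "rev xs" f]
      by (simp add: adjacency_eigenvalue_def eigenvalue_list_def R_def xs(1) len flip: xs_def)
    from this[of "\<lambda>l. 2 * (2 * real n + l - 1) / (2 * real n + l - real r)"] show ?thesis
      unfolding W(3) tn by simp
  qed
  finally have "(\<Sum>x\<in>#Z. 1 / x) + n = m + (t / (t + r) +
      (\<Sum>i = 2..n. 2 * (2 * real n + adjacency_eigenvalue G i - 1)
        / (2 * real n + adjacency_eigenvalue G i - real r)))" .
  moreover have "kemeny_constant ?H = (\<Sum>x\<in>#Z. 1 / x)"
    using size_Z zero nonneg unfolding Z_def by (rule kemeny_constant_eq_sum_proots)
  ultimately show ?thesis
    by (simp add: t_def)
qed

end
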